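(* Let $w:\mathbb{Z}\to(0,\infty)$ satisfy $\sum_{k\in\mathbb{Z}}w(k)=1$, let $\beta:\mathbb{Z}\to\mathbb{C}$ be such that both limits $\beta_{\pm\infty}:=\lim_{k\to\pm\infty}(\beta(k)-\beta(k-1))$ exist in $\mathbb{C}$ and satisfy $\beta_{\infty}\neq 0$ and $\beta_{-\infty}\neq 0$, and let $\alpha:\mathbb{Z}\to\mathbb{C}$ satisfy $\sum_{k\in\mathbb{Z}}|\beta(k)-\alpha(k)|^2w(k)<\infty$. Then there is no closed operator $D_{\beta,\alpha,w}$ in $H_{\tau_w}$ with $D^{min}_{\beta,\alpha,w}\subset D_{\beta,\alpha,w}\subset D^{max}_{\beta,\alpha,w}$ such that $D_{\beta,\alpha,w}$ has compact parametrices.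
   Context: Let $\{E_k\}_{k\in\mathbb{Z}}$ be the canonical basis of $\ell^2(\mathbb{Z})$, $UE_k=E_{k+1}$ the bilateral shift, and for $a:\mathbb{Z}\to\mathbb{C}$ let $a(\mathbb{K})$ be the diagonal operator $a(\mathbb{K})E_k=a(k)E_k$; then $a(\mathbb{K})U=Ua(\mathbb{K}+1)$, where $a(\mathbb{K}+1)E_k=a(k+1)E_k$. $H_{\tau_w}$ is the Hilbert space of formal series $f=\sum_{n\in\mathbb{Z}}U^nf_n(\mathbb{K})$, with $f_n:\mathbb{Z}\to\mathbb{C}$, such that $\|f\|^2=\sum_{n\in\mathbb{Z}}\sum_{k\in\mathbb{Z}}w(k)|f_n(k)|^2<\infty$. A function $a:\mathbb{Z}\to\mathbb{C}$ is eventually constant if there is $k_0$ such that $a$ is constant on $\{k\ge k_0\}$ and constant on $\{k\le -k_0\}$ (the two constants may differ). Let $\mathcal{A}$ be the set of finite sums $\sum_nU^na_n(\mathbb{K})$ with all $a_n$ eventually constant, and $\mathcal{A}_0\subset\mathcal{A}$ the set of such finite sums with all $a_n$ of finite support. Both are regarded as subspaces of $H_{\tau_w}$. Consider the operator $f\mapsto U\beta(\mathbb{K})f-fU\alpha(\mathbb{K})$, i.e. for $f=\sum_nU^nf_n(\mathbb{K})$, $$f\mapsto\sum_nU^{n+1}(D_nf_n)(\mathbb{K}),\qquad (D_nf_n)(k)=\beta(k+n)f_n(k)-\alpha(k)f_n(k+1).$$ $D^{max}_{\beta,\alpha,w}$ is the closure in $H_{\tau_w}$ of this operator with domain $\mathcal{A}$,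 and $D^{min}_{\beta,\alpha,w}$ is the closure of this operator with domain $\mathcal{A}_0$. A closed (densely defined) operator $D$ has compact parametrices if $(1+D^*D)^{-1/2}$ and $(1+DD^* )^{-1/2}$ are compact operators. *)

theory Defs
  imports "HOL-Analysis.Analysis" "HOL-Library.Function_Algebras"
begin

text \<open>
  A formal series \<open>\<Sum>n. U\<^sup>n f\<^sub>n(K)\<close> is represented by its coefficients: \<open>f n k\<close> is \<open>f\<^sub>n(k)\<close>.
  Addition, subtraction and zero of series are pointwise.
\<close>

type_synonym fseries = "int \<Rightarrow> int \<Rightarrow> complex"

definition fscale :: "complex \<Rightarrow> fseries \<Rightarrow> fseries" where
  "fscale c f = (\<lambda>n k. c * f n k)"

subsection \<open>The Hilbert space of formal series\<close>

definition Hspace :: "(int \<Rightarrow> real) \<Rightarrow> fseries set" where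
  "Hspace w = {f. (\<lambda>(n, k). w k * (cmod (f n k))\<^sup>2) summable_on UNIV}"

definition Hnorm :: "(int \<Rightarrow> real) \<Rightarrow> fseries \<Rightarrow> real" where
  "Hnorm w f = sqrt (\<Sum>\<^sub>\<infinity>(n, k)\<in>UNIV. w k * (cmod (f n k))\<^sup>2)"

definition Hinner :: "(int \<Rightarrow> real) \<Rightarrow> fseries \<Rightarrow> fseries \<Rightarrow> complex" where
  "Hinner w f g = (\<Sum>\<^sub>\<infinity>(n, k)\<in>UNIV. complex_of_real (w k) * f n k * cnj (g n k))"

text \<open>
  Membership in the space is part of convergence because \<open>infsum\<close> is 0 on
  non-summable families, so \<open>Hnorm\<close> is meaningless outside \<open>Hspace\<close>.
\<close>

definition Hlim :: "(int \<Rightarrow> real) \<Rightarrow> (nat \<Rightarrow> fseries) \<Rightarrow> fseries \<Rightarrow> bool" where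
  "Hlim w X f \<longleftrightarrow> (\<forall>i. X i \<in> Hspace w) \<and> f \<in> Hspace w \<and> (\<lambda>i. Hnorm w (X i - f)) \<longlonglongrightarrow> 0"

subsection \<open>Unbounded operators\<close>

text \<open>
  A (partially defined) operator is identified with its graph, so that inclusion of operators
  is inclusion of sets, the composition \<open>ST\<close> is \<open>T O S\<close>, and the inverse is the converse.
\<close>

type_synonym operator = "(fseries \<times> fseries) set"

definition linear_operator :: "(int \<Rightarrow> real) \<Rightarrow> operator \<Rightarrow> bool" where
  "linear_operator w T \<longleftrightarrow> T \<subseteq> Hspace w \<times> Hspace w \<and> single_valued T \<and> (0, 0) \<in> T \<and>
     (\<forall>(f, g)\<in>T. \<forall>(f', g')\<in>T. (f + f', g + g') \<in> T) \<and>
     (\<forall>c. \<forall>(f, g)\<in>T. (fscale c f, fscale c g) \<in> T)"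

definition op_closure :: "(int \<Rightarrow> real) \<Rightarrow> operator \<Rightarrow> operator" where
  "op_closure w T = {(f, g). \<exists>F G. (\<forall>i. (F i, G i) \<in> T) \<and> Hlim w F f \<and> Hlim w G g}"

definition closed_operator :: "(int \<Rightarrow> real) \<Rightarrow> operator \<Rightarrow> bool" where
  "closed_operator w T \<longleftrightarrow> linear_operator w T \<and> op_closure w T = T"

definition adjoint_op :: "(int \<Rightarrow> real) \<Rightarrow> operator \<Rightarrow> operator" where
  "adjoint_op w T = {(x, y). x \<in> Hspace w \<and> y \<in> Hspace w \<and>
     (\<forall>(f, g)\<in>T. Hinner w g x = Hinner w f y)}"

definition one_plus :: "operator \<Rightarrow> operator" where
  "one_plus T = {(f, f + g) | f g. (f, g) \<in> T}"

definition bounded_operator :: "(int \<Rightarrow> real) \<Rightarrow> operator \<Rightarrow> bool" where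
  "bounded_operator w S \<longleftrightarrow> linear_operator w S \<and> Domain S = Hspace w \<and>
     (\<exists>C. \<forall>(f, g)\<in>S. Hnorm w g \<le> C * Hnorm w f)"

definition positive_operator :: "(int \<Rightarrow> real) \<Rightarrow> operator \<Rightarrow> bool" where
  "positive_operator w S \<longleftrightarrow> (\<forall>(f, g)\<in>S. Hinner w g f \<in> \<real>\<^sub>\<ge>\<^sub>0)"

definition compact_operator :: "(int \<Rightarrow> real) \<Rightarrow> operator \<Rightarrow> bool" where
  "compact_operator w S \<longleftrightarrow> bounded_operator w S \<and>
     (\<forall>F G. (\<forall>i. (F i, G i) \<in> S) \<and> (\<exists>B. \<forall>i. Hnorm w (F i) \<le> B) \<longrightarrow>
        (\<exists>r g. strict_mono (r :: nat \<Rightarrow> nat) \<and> Hlim w (G \<circ> r) g))"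

text \<open>
  \<open>S = T\<^sup>-\<^sup>1\<^sup>/\<^sup>2\<close>: the positive bounded square root of \<open>T\<^sup>-\<^sup>1\<close>. For \<open>T = 1 + D\<^sup>*D\<close> and
  \<open>T = 1 + DD\<^sup>*\<close> with \<open>D\<close> closed and densely defined, \<open>T\<^sup>-\<^sup>1\<close> is bounded and positive on the
  whole space (von Neumann), so such an \<open>S\<close> exists and is unique.
\<close>

definition is_inv_sqrt :: "(int \<Rightarrow> real) \<Rightarrow> operator \<Rightarrow> operator \<Rightarrow> bool" where
  "is_inv_sqrt w T S \<longleftrightarrow> bounded_operator w S \<and> positive_operator w S \<and> S O S = T\<inverse>"

definition compact_parametrices :: "(int \<Rightarrow> real) \<Rightarrow> operator \<Rightarrow> bool" where
  "compact_parametrices w D \<longleftrightarrow>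
     (\<exists>S. is_inv_sqrt w (one_plus (D O adjoint_op w D)) S \<and> compact_operator w S) \<and>
     (\<exists>S. is_inv_sqrt w (one_plus (adjoint_op w D O D)) S \<and> compact_operator w S)"

subsection \<open>The operators \<open>D\<^sup>m\<^sup>i\<^sup>n\<close> and \<open>D\<^sup>m\<^sup>a\<^sup>x\<close>\<close>

definition eventually_constant :: "(int \<Rightarrow> complex) \<Rightarrow> bool" where
  "eventually_constant a \<longleftrightarrow> (\<exists>k0. (\<exists>c. \<forall>k\<ge>k0. a k = c) \<and> (\<exists>c. \<forall>k\<le>-k0. a k = c))"

definition alg_A :: "fseries set" where
  "alg_A = {f. finite {n. f n \<noteq> 0} \<and> (\<forall>n. eventually_constant (f n))}"

definition alg_A0 :: "fseries set" where
  "alg_A0 = {f. finite {n. f n \<noteq> 0} \<and> (\<forall>n. finite {k. f n k \<noteq> 0})}"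

definition Dcoeff :: "(int \<Rightarrow> complex) \<Rightarrow> (int \<Rightarrow> complex) \<Rightarrow> int \<Rightarrow> (int \<Rightarrow> complex) \<Rightarrow> int \<Rightarrow> complex" where
  "Dcoeff \<beta> \<alpha> n a = (\<lambda>k. \<beta> (k + n) * a k - \<alpha> k * a (k + 1))"

text \<open>The coefficient of \<open>U\<^sup>n\<close> in \<open>\<Sum>n. U\<^sup>n\<^sup>+\<^sup>1 (D\<^sub>n f\<^sub>n)(K)\<close> is \<open>D\<^sub>n\<^sub>-\<^sub>1 f\<^sub>n\<^sub>-\<^sub>1\<close>.\<close>

definition Dformal :: "(int \<Rightarrow> complex) \<Rightarrow> (int \<Rightarrow> complex) \<Rightarrow> fseries \<Rightarrow> fseries" where
  "Dformal \<beta> \<alpha> f = (\<lambda>n. Dcoeff \<beta> \<alpha> (n - 1) (f (n - 1)))"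

definition Dmax :: "(int \<Rightarrow> complex) \<Rightarrow> (int \<Rightarrow> complex) \<Rightarrow> (int \<Rightarrow> real) \<Rightarrow> operator" where
  "Dmax \<beta> \<alpha> w = op_closure w {(f, Dformal \<beta> \<alpha> f) | f. f \<in> alg_A}"

definition Dmin :: "(int \<Rightarrow> complex) \<Rightarrow> (int \<Rightarrow> complex) \<Rightarrow> (int \<Rightarrow> real) \<Rightarrow> operator" where
  "Dmin \<beta> \<alpha> w = op_closure w {(f, Dformal \<beta> \<alpha> f) | f. f \<in> alg_A0}"

end

theory Submission
  imports Defs
begin

text \<open>
  The component of degree \<open>-N\<close> contains a nonzero \<open>\<phi>\<close> supported in \<open>{0..N}\<close> with
  \<open>\<beta>(k - N) \<phi>(k) = \<alpha>(k) \<phi>(k + 1)\<close> for \<open>0 \<le> k < N\<close>. Only the two boundary terms \<open>-\<alpha>(-1) \<phi>(0)\<close> at \<open>-1\<close>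
  and \<open>\<beta>(0) \<phi>(N)\<close> at \<open>N\<close> survive in \<open>D\<phi>\<close>, so \<open>\<parallel>D\<phi>\<parallel> \<le> C \<parallel>\<phi>\<parallel>\<close> with \<open>C\<close> independent of \<open>N\<close>.
  Normalizing, one obtains an orthonormal sequence that is bounded in the graph norm of
  \<open>D\<^sup>m\<^sup>i\<^sup>n\<close>, which contradicts the compactness of \<open>(1 + D\<^sup>*D)\<^sup>-\<^sup>1\<^sup>/\<^sup>2\<close>.
\<close>

section \<open>The Hilbert space of formal series\<close>

text \<open>This is the single term \<open>U^m a(K)\<close>. Terms of different degree
  \<open>m\<close> are orthogonal, and degree is what separates the test vectors later on.\<close>

definition homog :: "int \<Rightarrow> (int \<Rightarrow> complex) \<Rightarrow> fseries" where
  "homog m a = (\<lambda>n k. if n = m then a k else 0)"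

lemma diff_eq_add_fscale: "f - g = f + fscale (-1) g"
  by (auto simp: fscale_def fun_eq_iff)

context
  fixes w :: "int \<Rightarrow> real"
  assumes w_nonneg: "\<And>k. 0 \<le> w k"
begin

section \<open>Convergence of the inner product, vector space operations, Cauchy-Schwarz\<close>

lemma Hinner_abs_summable:
  assumes "f \<in> Hspace w" "g \<in> Hspace w"
  shows "(\<lambda>p. norm (case p of (n, k) \<Rightarrow> complex_of_real (w k) * f n k * cnj (g n k))) summable_on UNIV"
proof (rule Infinite_Sum.abs_summable_on_comparison_test')
  show "(\<lambda>(n, k). w k * (cmod (f n k))\<^sup>2 + w k * (cmod (g n k))\<^sup>2) summable_on UNIV"
    using summable_on_add[of "\<lambda>(n, k). w k * (cmod (f n k))\<^sup>2" UNIV "\<lambda>(n, k). w k * (cmod (g n k))\<^sup>2"]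
      assms unfolding Hspace_def by (simp add: case_prod_unfold)
  fix p :: "int \<times> int"
  obtain n k where p: "p = (n, k)" by (cases p)
  \<comment> \<open>From \<open>2xy \<le> x^2 + y^2\<close> and \<open>xy \<ge> 0\<close>; after
    multiplication by the weight this is the summable majorant.\<close>
  have "cmod (f n k) * cmod (g n k) \<le> (cmod (f n k))\<^sup>2 + (cmod (g n k))\<^sup>2"
    using sum_squares_bound[of "cmod (f n k)" "cmod (g n k)"]
      mult_nonneg_nonneg[OF norm_ge_zero norm_ge_zero, of "f n k" "g n k"] by linarith
  from mult_left_mono[OF this w_nonneg[of k]]
  show "norm (case p of (n, k) \<Rightarrow> complex_of_real (w k) * f n k * cnj (g n k))
      \<le> (case p of (n, k) \<Rightarrow> w k * (cmod (f n k))\<^sup>2 + w k * (cmod (g n k))\<^sup>2)"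
    using w_nonneg[of k] by (simp add: p norm_mult algebra_simps)
qed

lemma Hinner_summable:
  assumes "f \<in> Hspace w" "g \<in> Hspace w"
  shows "(\<lambda>(n, k). complex_of_real (w k) * f n k * cnj (g n k)) summable_on UNIV"
  using abs_summable_summable[OF Hinner_abs_summable[OF assms]] .

lemma Hspace_add:
  assumes "f \<in> Hspace w" "g \<in> Hspace w"
  shows "f + g \<in> Hspace w"
  unfolding Hspace_def mem_Collect_eq
proof (rule summable_on_comparison_test)
  show "(\<lambda>(n, k). 2 * (w k * (cmod (f n k))\<^sup>2) + 2 * (w k * (cmod (g n k))\<^sup>2)) summable_on UNIV"
    using summable_on_add[OF summable_on_cmult_right[of "\<lambda>(n, k). w k * (cmod (f n k))\<^sup>2" UNIV 2]
        summable_on_cmult_right[of "\<lambda>(n, k). w k * (cmod (g n k))\<^sup>2" UNIV 2]]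
      assms unfolding Hspace_def by (simp add: case_prod_unfold)
  fix p :: "int \<times> int"
  obtain n k where p: "p = (n, k)" by (cases p)
  have "(cmod (f n k + g n k))\<^sup>2 \<le> (cmod (f n k) + cmod (g n k))\<^sup>2"
    by (intro power_mono norm_triangle_ineq) auto
  also have "\<dots> \<le> 2 * (cmod (f n k))\<^sup>2 + 2 * (cmod (g n k))\<^sup>2"
    using sum_squares_bound[of "cmod (f n k)" "cmod (g n k)"] by (simp add: power2_sum)
  finally have "(cmod (f n k + g n k))\<^sup>2 \<le> 2 * (cmod (f n k))\<^sup>2 + 2 * (cmod (g n k))\<^sup>2" .
  from mult_left_mono[OF this w_nonneg[of k]]
  show "(case p of (n, k) \<Rightarrow> w k * (cmod ((f + g) n k))\<^sup>2)
      \<le> (case p of (n, k) \<Rightarrow> 2 * (w k * (cmod (f n k))\<^sup>2) + 2 * (w k * (cmod (g n k))\<^sup>2))"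
    by (simp add: p algebra_simps)
qed (use w_nonneg in auto)

lemma Hspace_fscale:
  assumes "f \<in> Hspace w"
  shows "fscale c f \<in> Hspace w"
  using summable_on_cmult_right[of "\<lambda>(n, k). w k * (cmod (f n k))\<^sup>2" UNIV "(cmod c)\<^sup>2"] assms
  unfolding Hspace_def fscale_def
  by (simp add: case_prod_unfold norm_mult power_mult_distrib mult_ac)

lemma Hspace_diff:
  assumes "f \<in> Hspace w" "g \<in> Hspace w"
  shows "f - g \<in> Hspace w"
  unfolding diff_eq_add_fscale by (intro Hspace_add Hspace_fscale assms)

lemma Hinner_add_left:
  assumes "f \<in> Hspace w" "f' \<in> Hspace w" "g \<in> Hspace w"
  shows "Hinner w (f + f') g = Hinner w f g + Hinner w f' g"
  using infsum_add[OF Hinner_summable[OF assms(1,3)] Hinner_summable[OF assms(2,3)]]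
  unfolding Hinner_def by (simp add: case_prod_unfold algebra_simps)

lemma Hinner_add_right:
  assumes "f \<in> Hspace w" "g \<in> Hspace w" "g' \<in> Hspace w"
  shows "Hinner w f (g + g') = Hinner w f g + Hinner w f g'"
  using infsum_add[OF Hinner_summable[OF assms(1,2)] Hinner_summable[OF assms(1,3)]]
  unfolding Hinner_def by (simp add: case_prod_unfold algebra_simps)

lemma Hnorm_nonneg: "0 \<le> Hnorm w f"
  unfolding Hnorm_def by (intro real_sqrt_ge_zero infsum_nonneg) (auto simp: w_nonneg)

lemma Hnorm_sq: "(Hnorm w f)\<^sup>2 = (\<Sum>\<^sub>\<infinity>(n, k)\<in>UNIV. w k * (cmod (f n k))\<^sup>2)"
  unfolding Hnorm_def by (rule real_sqrt_pow2) (intro infsum_nonneg, auto simp: w_nonneg)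

lemma Hinner_self:
  assumes "f \<in> Hspace w"
  shows "Hinner w f f = complex_of_real ((Hnorm w f)\<^sup>2)"
proof -
  have "((\<lambda>(n, k). w k * (cmod (f n k))\<^sup>2) has_sum (Hnorm w f)\<^sup>2) UNIV"
    using assms unfolding Hnorm_sq Hspace_def by (simp add: has_sum_infsum)
  note * = infsumI[OF has_sum_of_real[OF this]]
  have "Hinner w f f = (\<Sum>\<^sub>\<infinity>p\<in>UNIV. complex_of_real (case p of (n, k) \<Rightarrow> w k * (cmod (f n k))\<^sup>2))"
    unfolding Hinner_def
    by (intro infsum_cong) (auto simp: mult.assoc simp flip: complex_norm_square)
  then show ?thesis
    using * by simp
qed

text \<open>Splitting the weight as \<open>sqrt (w k) * sqrt (w k)\<close> reduces each finite
  partial sum to the finite inequality for \<open>L2_set\<close>. The two resulting factors are at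
  most the full norms, so the bound passes to the infinite sum.\<close>

lemma Hinner_Cauchy_Schwarz:
  assumes f: "f \<in> Hspace w" and g: "g \<in> Hspace w"
  shows "cmod (Hinner w f g) \<le> Hnorm w f * Hnorm w g"
proof -
  let ?t = "\<lambda>(n, k). complex_of_real (w k) * f n k * cnj (g n k)"
  have sqrt_le: "L2_set (\<lambda>(n, k). sqrt (w k) * cmod (h n k)) F \<le> Hnorm w h"
    if h: "h \<in> Hspace w" and F: "finite F" for h F
  proof -
    have "(\<Sum>p\<in>F. case p of (n, k) \<Rightarrow> w k * (cmod (h n k))\<^sup>2)
        \<le> (\<Sum>\<^sub>\<infinity>(n, k)\<in>UNIV. w k * (cmod (h n k))\<^sup>2)"
      using h F by (intro finite_sum_le_infsum) (auto simp: Hspace_def w_nonneg)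
    then show ?thesis
      unfolding L2_set_def Hnorm_def
      by (simp add: case_prod_unfold power_mult_distrib w_nonneg)
  qed
  have "cmod (Hinner w f g) \<le> (\<Sum>\<^sub>\<infinity>p\<in>UNIV. norm (?t p))"
    unfolding Hinner_def by (rule norm_infsum_bound[OF Hinner_abs_summable[OF f g]])
  also have "\<dots> \<le> Hnorm w f * Hnorm w g"
  proof (rule infsum_le_finite_sums[OF Hinner_abs_summable[OF f g]])
    fix F :: "(int \<times> int) set"
    assume F: "finite F"
    have "(\<Sum>p\<in>F. norm (?t p)) = (\<Sum>p\<in>F. \<bar>(\<lambda>(n, k). sqrt (w k) * cmod (f n k)) p\<bar> *
        \<bar>(\<lambda>(n, k). sqrt (w k) * cmod (g n k)) p\<bar>)"
    proof (rule sum.cong[OF refl])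
      fix p :: "int \<times> int"
      obtain n k where p: "p = (n, k)" by (cases p)
      have "w k * x * y = \<bar>sqrt (w k) * x\<bar> * \<bar>sqrt (w k) * y\<bar>" if "0 \<le> x" "0 \<le> y" for x y
      proof -
        have "\<bar>sqrt (w k) * x\<bar> * \<bar>sqrt (w k) * y\<bar> = (sqrt (w k) * sqrt (w k)) * x * y"
          using that w_nonneg[of k] by (simp add: abs_mult)
        then show ?thesis using w_nonneg[of k] by simp
      qed
      then show "norm (?t p) = \<bar>(\<lambda>(n, k). sqrt (w k) * cmod (f n k)) p\<bar> *
          \<bar>(\<lambda>(n, k). sqrt (w k) * cmod (g n k)) p\<bar>"
        using w_nonneg[of k] by (simp add: p norm_mult)
    qed
    also have "\<dots> \<le> L2_set (\<lambda>(n, k). sqrt (w k) * cmod (f n k)) F *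
        L2_set (\<lambda>(n, k). sqrt (w k) * cmod (g n k)) F"
      by (rule L2_set_mult_ineq)
    also have "\<dots> \<le> Hnorm w f * Hnorm w g"
      by (intro mult_mono sqrt_le f g F L2_set_nonneg Hnorm_nonneg)
    finally show "(\<Sum>p\<in>F. norm (?t p)) \<le> Hnorm w f * Hnorm w g" .
  qed
  finally show ?thesis .
qed

section \<open>Homogeneous components and weak convergence to zero\<close>

lemma row_summable:
  assumes "f \<in> Hspace w"
  shows "(\<lambda>k. w k * (cmod (f n k))\<^sup>2) summable_on UNIV"
  using summable_on_SigmaD1[of "\<lambda>n k. w k * (cmod (f n k))\<^sup>2" UNIV "\<lambda>_. UNIV" n] assms
  unfolding Hspace_def by simp

lemma homog_sum:
  "(\<Sum>\<^sub>\<infinity>(n, k)\<in>UNIV. w k * (cmod (homog m a n k))\<^sup>2) = (\<Sum>\<^sub>\<infinity>k. w k * (cmod (a k))\<^sup>2)"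
proof -
  have "(\<Sum>\<^sub>\<infinity>(n, k)\<in>UNIV. w k * (cmod (homog m a n k))\<^sup>2)
      = (\<Sum>\<^sub>\<infinity>(n, k)\<in>Pair m ` UNIV. w k * (cmod (homog m a n k))\<^sup>2)"
    by (intro infsum_cong_neutral) (auto simp: homog_def)
  also have "\<dots> = (\<Sum>\<^sub>\<infinity>k. w k * (cmod (a k))\<^sup>2)"
    by (subst infsum_reindex) (auto simp: homog_def o_def inj_on_def)
  finally show ?thesis .
qed

lemma homog_in_Hspace:
  assumes "(\<lambda>k. w k * (cmod (a k))\<^sup>2) summable_on UNIV"
  shows "homog m a \<in> Hspace w"
proof -
  have "(\<lambda>(n, k). w k * (cmod (homog m a n k))\<^sup>2) summable_on Pair m ` UNIV"
    using assms by (subst summable_on_reindex) (auto simp: homog_def o_def inj_on_def)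
  also have "?this \<longleftrightarrow> (\<lambda>(n, k). w k * (cmod (homog m a n k))\<^sup>2) summable_on UNIV"
    by (intro summable_on_cong_neutral) (auto simp: homog_def)
  finally show ?thesis unfolding Hspace_def by simp
qed

lemma homog_finite_support:
  assumes "finite A" "\<And>k. k \<notin> A \<Longrightarrow> a k = 0"
  shows "homog m a \<in> Hspace w" "(Hnorm w (homog m a))\<^sup>2 = (\<Sum>k\<in>A. w k * (cmod (a k))\<^sup>2)"
proof -
  have "(\<lambda>k. w k * (cmod (a k))\<^sup>2) summable_on A \<longleftrightarrow> (\<lambda>k. w k * (cmod (a k))\<^sup>2) summable_on UNIV"
    by (intro summable_on_cong_neutral) (auto simp: assms)
  then show "homog m a \<in> Hspace w"
    using assms(1) by (intro homog_in_Hspace) auto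
  have "(\<Sum>\<^sub>\<infinity>k. w k * (cmod (a k))\<^sup>2) = (\<Sum>\<^sub>\<infinity>k\<in>A. w k * (cmod (a k))\<^sup>2)"
    by (intro infsum_cong_neutral) (auto simp: assms)
  then show "(Hnorm w (homog m a))\<^sup>2 = (\<Sum>k\<in>A. w k * (cmod (a k))\<^sup>2)"
    using assms(1) by (simp add: Hnorm_sq homog_sum)
qed

text \<open>By Fubini the squared row norms of \<open>f\<close> form a summable family, so along the
  degrees \<open>0, -1, -2, ...\<close> they are the terms of a convergent series.\<close>

lemma row_norm_tendsto_0:
  assumes "f \<in> Hspace w"
  shows "(\<lambda>i. Hnorm w (homog (- int i) (f (- int i)))) \<longlonglongrightarrow> 0"
proof -
  have "(\<lambda>n. \<Sum>\<^sub>\<infinity>k. w k * (cmod (f n k))\<^sup>2) summable_on UNIV"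
    using summable_on_Sigma_banach[of "\<lambda>n k. w k * (cmod (f n k))\<^sup>2" UNIV "\<lambda>_. UNIV"] assms
    unfolding Hspace_def by simp
  then have "(\<lambda>n. \<Sum>\<^sub>\<infinity>k. w k * (cmod (f n k))\<^sup>2) summable_on range (\<lambda>i. - int i)"
    by (rule summable_on_subset_banach) auto
  then have "(\<lambda>i. \<Sum>\<^sub>\<infinity>k. w k * (cmod (f (- int i) k))\<^sup>2) summable_on UNIV"
    by (subst (asm) summable_on_reindex) (auto simp: inj_on_def o_def)
  then have "(\<lambda>i. \<Sum>\<^sub>\<infinity>k. w k * (cmod (f (- int i) k))\<^sup>2) \<longlonglongrightarrow> 0"
    by (intro summable_LIMSEQ_zero summable_on_imp_summable)
  from tendsto_real_sqrt[OF this] show ?thesis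
    unfolding Hnorm_def homog_sum by simp
qed

text \<open>A vector of degree \<open>-i\<close> pairs only with the row \<open>-i\<close> of
  \<open>f\<close>, and the norm of that row tends to 0. Hence bounded vectors of degrees
  \<open>0, -1, -2, ...\<close> converge weakly to zero.\<close>

lemma Hinner_homog_tendsto_0:
  assumes f: "f \<in> Hspace w"
    and a: "\<And>i. homog (- int i) (a i) \<in> Hspace w" "\<And>i. Hnorm w (homog (- int i) (a i)) \<le> B"
  shows "(\<lambda>i. Hinner w f (homog (- int i) (a i))) \<longlonglongrightarrow> 0"
proof (rule Lim_null_comparison)
  show "(\<lambda>i. Hnorm w (homog (- int i) (f (- int i))) * B) \<longlonglongrightarrow> 0"
    using tendsto_mult_left_zero[OF row_norm_tendsto_0[OF f]] by simp
  have "cmod (Hinner w f (homog (- int i) (a i))) \<le> Hnorm w (homog (- int i) (f (- int i))) * B" for i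
  proof -
    have "Hinner w f (homog (- int i) (a i))
        = Hinner w (homog (- int i) (f (- int i))) (homog (- int i) (a i))"
      unfolding Hinner_def by (intro infsum_cong) (auto simp: homog_def)
    also have "cmod \<dots> \<le> Hnorm w (homog (- int i) (f (- int i))) * Hnorm w (homog (- int i) (a i))"
      by (intro Hinner_Cauchy_Schwarz homog_in_Hspace row_summable f a)
    also have "\<dots> \<le> Hnorm w (homog (- int i) (f (- int i))) * B"
      by (intro mult_left_mono a Hnorm_nonneg)
    finally show ?thesis .
  qed
  then show "\<forall>\<^sub>F i in sequentially. norm (Hinner w f (homog (- int i) (a i)))
      \<le> Hnorm w (homog (- int i) (f (- int i))) * B"
    by (rule always_eventually[OF allI])
qed

section \<open>Graph-bounded sequences and compact parametrices\<close>

text \<open>As a relation, \<open>D O adjoint_op w D\<close> applies \<open>D\<close> first, so it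
  is \<open>D^*D\<close>. Applying \<open>S\<close> twice gives
  \<open>u = (1 + D^*D)^{-1} f\<close>, and \<open>v = Du\<close>, \<open>x = D^* v\<close> unfold
  \<open>(1 + D^*D) u = f\<close>.\<close>

lemma inv_sqrt_preimage:
  assumes S: "is_inv_sqrt w (one_plus (D O adjoint_op w D)) S" and f: "f \<in> Hspace w"
  obtains y u v x where "(f, y) \<in> S" "(y, u) \<in> S" "(u, v) \<in> D" "(v, x) \<in> adjoint_op w D" "f = u + x"
proof -
  have dom: "Domain S = Hspace w" and sub: "S \<subseteq> Hspace w \<times> Hspace w"
    and comp: "S O S = (one_plus (D O adjoint_op w D))\<inverse>"
    using S unfolding is_inv_sqrt_def bounded_operator_def linear_operator_def by auto
  obtain y where y: "(f, y) \<in> S" using f dom by blast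
  then obtain u where u: "(y, u) \<in> S" using dom sub by blast
  then have "(u, f) \<in> one_plus (D O adjoint_op w D)" using comp y by blast
  then show thesis using that y u unfolding one_plus_def by blast
qed

lemma bounded_operator_Hlim:
  assumes S: "bounded_operator w S" and XY: "\<And>i. (X i, Y i) \<in> S"
    and lim: "Hlim w X x" and xy: "(x, y) \<in> S"
  shows "Hlim w Y y"
proof -
  have sub: "S \<subseteq> Hspace w \<times> Hspace w"
    and add: "\<And>f g f' g'. (f, g) \<in> S \<Longrightarrow> (f', g') \<in> S \<Longrightarrow> (f + f', g + g') \<in> S"
    and scale: "\<And>c f g. (f, g) \<in> S \<Longrightarrow> (fscale c f, fscale c g) \<in> S"
    using S unfolding bounded_operator_def linear_operator_def by fast+
  obtain C where C: "\<And>f g. (f, g) \<in> S \<Longrightarrow> Hnorm w g \<le> C * Hnorm w f"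
    using S unfolding bounded_operator_def by fast
  have "(X i - x, Y i - y) \<in> S" for i
    unfolding diff_eq_add_fscale by (intro add scale XY xy)
  then have "\<forall>i. norm (Hnorm w (Y i - y)) \<le> Hnorm w (X i - x) * C"
    using C Hnorm_nonneg by (simp add: mult.commute)
  moreover have "(\<lambda>i. Hnorm w (X i - x) * C) \<longlonglongrightarrow> 0"
    using lim unfolding Hlim_def by (intro tendsto_mult_left_zero) simp
  ultimately have "(\<lambda>i. Hnorm w (Y i - y)) \<longlonglongrightarrow> 0"
    by (rule Lim_null_comparison[OF always_eventually])
  then show ?thesis
    using sub XY xy unfolding Hlim_def by blast
qed

text \<open>Put \<open>U = (1 + D^*D)^{-1} F\<close> and \<open>V = DU\<close>. Compactness makes
  \<open>U\<close> converge in norm along a subsequence; as \<open>F\<close> tends weakly to zero,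
  the energy \<open><U, F> = |U|^2 + |V|^2\<close> tends to 0. The graph bound on \<open>F\<close>
  prevents this, because it forces \<open>1 \<le> |U| + C |V|\<close>.\<close>

lemma not_compact_inv_sqrt:
  assumes S: "is_inv_sqrt w (one_plus (D O adjoint_op w D)) S" and cpt: "compact_operator w S"
    and D: "D \<subseteq> Hspace w \<times> Hspace w"
    and FG: "\<And>i. (F i, G i) \<in> D" and F: "\<And>i. Hnorm w (F i) = 1" and G: "\<And>i. Hnorm w (G i) \<le> C"
    and weak: "\<And>f. f \<in> Hspace w \<Longrightarrow> (\<lambda>i. Hinner w f (F i)) \<longlonglongrightarrow> 0"
  shows False
proof -
  have FH: "F i \<in> Hspace w" and GH: "G i \<in> Hspace w" for i using FG D by blast+
  have "\<forall>i. \<exists>y u v x. (F i, y) \<in> S \<and> (y, u) \<in> S \<and> (u, v) \<in> D \<and> (v, x) \<in> adjoint_op w D \<and> F i = u + x"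
    using inv_sqrt_preimage[OF S FH] by metis
  then obtain Y U V X where Y: "\<And>i. (F i, Y i) \<in> S" and U: "\<And>i. (Y i, U i) \<in> S"
    and V: "\<And>i. (U i, V i) \<in> D" and X: "\<And>i. (V i, X i) \<in> adjoint_op w D"
    and sum: "\<And>i. F i = U i + X i" by metis
  have UH: "U i \<in> Hspace w" and VH: "V i \<in> Hspace w" for i using V D by blast+
  have XH: "X i \<in> Hspace w" for i using X unfolding adjoint_op_def by blast
  have adj: "Hinner w g (V i) = Hinner w f (X i)" if "(f, g) \<in> D" for f g i
    using X that unfolding adjoint_op_def by fast
  \<comment> \<open>Expand \<open>F = U + X\<close> with \<open>X = D^* V\<close>; since
    \<open>V = DU\<close>, the cross term is \<open><U, X> = <V, V>\<close>.\<close>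
  have energy: "Hinner w (U i) (F i) = of_real ((Hnorm w (U i))\<^sup>2 + (Hnorm w (V i))\<^sup>2)" for i
    using Hinner_add_right[OF UH UH XH, of i i i] adj[OF V, of i i] sum[of i] by (simp add: Hinner_self UH VH)
  \<comment> \<open>Now \<open>F\<close> is paired with \<open>U + X\<close> instead: moving the
    adjoint across turns \<open><F, X>\<close> into \<open><G, V>\<close>, where the bound on
    \<open>G\<close> applies.\<close>
  have lower: "1 \<le> Hnorm w (U i) + C * Hnorm w (V i)" for i
  proof -
    have "1 = Hinner w (F i) (F i)" by (simp add: Hinner_self F FH)
    also have "\<dots> = Hinner w (F i) (U i + X i)" using sum by simp
    also have "\<dots> = Hinner w (F i) (U i) + Hinner w (G i) (V i)"
      using Hinner_add_right[OF FH UH XH] adj[OF FG] by simp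
    finally have "1 = cmod (Hinner w (F i) (U i) + Hinner w (G i) (V i))" by (metis norm_one)
    also have "\<dots> \<le> Hnorm w (F i) * Hnorm w (U i) + Hnorm w (G i) * Hnorm w (V i)"
      by (intro order.trans[OF norm_triangle_ineq] add_mono Hinner_Cauchy_Schwarz FH UH GH VH)
    also have "\<dots> \<le> Hnorm w (U i) + C * Hnorm w (V i)"
      using mult_right_mono[OF G Hnorm_nonneg] by (simp add: F)
    finally show ?thesis .
  qed
  have bdd: "bounded_operator w S" using S unfolding is_inv_sqrt_def by blast
  \<comment> \<open>Compactness is applied to the first factor \<open>Y = S F\<close>; the second
    application of \<open>S\<close>, being continuous, carries the convergence over to
    \<open>U = S Y\<close>.\<close>
  obtain r y where r: "strict_mono (r :: nat \<Rightarrow> nat)" and y: "Hlim w (Y \<circ> r) y"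
    using cpt Y F unfolding compact_operator_def by (metis order_refl)
  then obtain u where u: "(y, u) \<in> S"
    using bdd unfolding bounded_operator_def Hlim_def by blast
  have limU: "Hlim w (U \<circ> r) u"
    using bounded_operator_Hlim[OF bdd _ y u, of "U \<circ> r"] U by simp
  then have uH: "u \<in> Hspace w" unfolding Hlim_def by blast
  \<comment> \<open>Split \<open>U = (U - u) + u\<close>: the first part tends to 0 in norm against
    unit vectors, the second is fixed and meets a weakly null sequence.\<close>
  have "(\<lambda>i. Hinner w (U (r i)) (F (r i))) \<longlonglongrightarrow> 0"
  proof -
    have "cmod (Hinner w (U (r i) - u) (F (r i))) \<le> Hnorm w (U (r i) - u)" for i
      using Hinner_Cauchy_Schwarz[OF Hspace_diff[OF UH uH] FH, of "r i" "r i"] by (simp add: F)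
    then have "\<forall>i. cmod (Hinner w (U (r i) - u) (F (r i))) \<le> Hnorm w (U (r i) - u)" ..
    moreover have "(\<lambda>i. Hnorm w (U (r i) - u)) \<longlonglongrightarrow> 0"
      using limU unfolding Hlim_def by simp
    ultimately have "(\<lambda>i. Hinner w (U (r i) - u) (F (r i))) \<longlonglongrightarrow> 0"
      by (rule Lim_null_comparison[OF always_eventually])
    moreover have "(\<lambda>i. Hinner w u (F (r i))) \<longlonglongrightarrow> 0"
      using LIMSEQ_subseq_LIMSEQ[OF weak[OF uH] r] by (simp add: o_def)
    ultimately have "(\<lambda>i. Hinner w (U (r i) - u) (F (r i)) + Hinner w u (F (r i))) \<longlonglongrightarrow> 0"
      by (rule tendsto_add_zero)
    then show ?thesis
      using Hinner_add_left[OF Hspace_diff[OF UH uH] uH FH] by simp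
  qed
  then have E: "(\<lambda>i. (Hnorm w (U (r i)))\<^sup>2 + (Hnorm w (V (r i)))\<^sup>2) \<longlonglongrightarrow> 0"
    by (auto dest: tendsto_Re simp only: energy Re_complex_of_real zero_complex.sel)
  have "(\<lambda>i. sqrt ((Hnorm w (U (r i)))\<^sup>2 + (Hnorm w (V (r i)))\<^sup>2)) \<longlonglongrightarrow> 0"
    using tendsto_real_sqrt[OF E] by simp
  note * = Lim_null_comparison[OF always_eventually this]
  have "(\<lambda>i. Hnorm w (U (r i))) \<longlonglongrightarrow> 0" "(\<lambda>i. Hnorm w (V (r i))) \<longlonglongrightarrow> 0"
    by (intro * allI; simp add: Hnorm_nonneg real_sqrt_sum_squares_ge1 real_sqrt_sum_squares_ge2)+
  then have "(\<lambda>i. Hnorm w (U (r i)) + C * Hnorm w (V (r i))) \<longlonglongrightarrow> 0"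
    by (intro tendsto_add_zero tendsto_mult_right_zero)
  from LIMSEQ_le_const[OF this, of 1] lower show False by simp
qed

end

section \<open>Approximate null vectors\<close>

text \<open>The condition is the first-order recurrence
  \<open>\<beta>(k + n) a(k) = \<alpha>(k) a(k + 1)\<close> on a finite window; the induction
  enlarges the window by one point on the right. The solution must stay nonzero even where \<alpha>
  or \<beta> vanishes.\<close>

lemma Dcoeff_local_solution:
  "\<exists>a. (\<exists>k. a k \<noteq> 0) \<and> (\<forall>k. k \<notin> {0..int m} \<longrightarrow> a k = 0) \<and>
       (\<forall>k\<in>{0..<int m}. Dcoeff \<beta> \<alpha> n a k = 0)"
proof (induction m)
  case 0
  show ?case by (rule exI[of _ "\<lambda>k. if k = 0 then 1 else 0"]) auto
next
  case (Suc m)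
  then obtain a where a: "\<exists>k. a k \<noteq> 0" "\<And>k. k \<notin> {0..int m} \<Longrightarrow> a k = 0"
    "\<And>k. k \<in> {0..<int m} \<Longrightarrow> Dcoeff \<beta> \<alpha> n a k = 0" by blast
  show ?case
  proof (cases "\<alpha> (int m) = 0")
    case True
    \<comment> \<open>The recurrence may have no continuation here, so the old solution is
      discarded. The unit mass at \<open>m + 1\<close> enters the window only through the equation
      at \<open>m\<close>, where its coefficient \<open>\<alpha>(m)\<close> is zero.\<close>
    show ?thesis
      by (rule exI[of _ "\<lambda>k. if k = int m + 1 then 1 else 0"]) (auto simp: Dcoeff_def True)
  next
    case False
    \<comment> \<open>The new value is forced by the equation at \<open>m\<close>. The earlier
      equations involve only points up to \<open>m\<close>, where \<open>b\<close> agrees with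
      \<open>a\<close>.\<close>
    define b where "b = a(int m + 1 := \<beta> (int m + n) * a (int m) / \<alpha> (int m))"
    have "\<exists>k. b k \<noteq> 0"
      using a(1,2) unfolding b_def by (metis atLeastAtMost_iff fun_upd_other zle_add1_eq_le less_irrefl)
    moreover have "b k = 0" if "k \<notin> {0..int (Suc m)}" for k
      using that a(2)[of k] by (auto simp: b_def)
    moreover have "Dcoeff \<beta> \<alpha> n b k = 0" if "k \<in> {0..<int (Suc m)}" for k
    proof (cases "k = int m")
      case True
      then show ?thesis using False by (simp add: Dcoeff_def b_def)
    next
      case neq: False
      then show ?thesis using that a(3)[of k] by (auto simp: Dcoeff_def b_def)
    qed
    ultimately show ?thesis by blast
  qed
qed

section \<open>Unit vectors in the domain of the minimal operator with bounded images\<close>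

lemma Dformal_homog: "Dformal \<beta> \<alpha> (homog m a) = homog (m + 1) (Dcoeff \<beta> \<alpha> m a)"
  by (auto simp: Dformal_def Dcoeff_def homog_def fun_eq_iff)

lemma homog_in_alg_A0:
  assumes "finite A" "\<And>k. k \<notin> A \<Longrightarrow> a k = 0"
  shows "homog m a \<in> alg_A0"
proof -
  have "{n. homog m a n \<noteq> 0} \<subseteq> {m}" by (auto simp: homog_def fun_eq_iff)
  moreover have "{k. homog m a n k \<noteq> 0} \<subseteq> A" for n using assms(2) by (auto simp: homog_def)
  ultimately show ?thesis
    unfolding alg_A0_def using assms(1) by (blast intro: finite_subset)
qed

lemma op_closure_superset:
  assumes "(f, g) \<in> T" "f \<in> Hspace w" "g \<in> Hspace w"
  shows "(f, g) \<in> op_closure w T"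
proof -
  have "Hnorm w 0 = 0" by (simp add: Hnorm_def case_prod_unfold)
  then have "Hlim w (\<lambda>_. h) h" if "h \<in> Hspace w" for h
    using that unfolding Hlim_def by simp
  then show ?thesis
    unfolding op_closure_def
    by (simp, intro exI[of _ "\<lambda>_. f"] exI[of _ "\<lambda>_. g"]) (simp add: assms)
qed

text \<open>The constant collects the two boundary terms. With degree \<open>-i\<close> and window
  \<open>{0..i}\<close>, the coefficient at the right end is
  \<open>\<beta>(i - i) = \<beta>(0)\<close>, whatever \<open>i\<close> is, and its weight
  \<open>w(i)\<close> is unchanged. At the left end the value at 0 moves to -1, which costs the
  ratio \<open>w(-1) / w(0)\<close>.\<close>

lemma approximate_null_vectors:
  fixes w :: "int \<Rightarrow> real"
  assumes w_pos: "\<And>k. w k > 0"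
  shows "\<exists>a. \<forall>i. homog (- int i) (a i) \<in> Hspace w \<and> Hnorm w (homog (- int i) (a i)) = 1 \<and>
    (homog (- int i) (a i), Dformal \<beta> \<alpha> (homog (- int i) (a i))) \<in> Dmin \<beta> \<alpha> w \<and>
    Hnorm w (Dformal \<beta> \<alpha> (homog (- int i) (a i)))
      \<le> sqrt ((cmod (\<beta> 0))\<^sup>2 + (cmod (\<alpha> (-1)))\<^sup>2 * w (-1) / w 0)"
proof (intro choice allI)
  fix i
  have w0: "\<And>k. 0 \<le> w k" using w_pos less_imp_le by blast
  obtain b where b: "\<exists>k. b k \<noteq> 0" "\<And>k. k \<notin> {0..int i} \<Longrightarrow> b k = 0"
    "\<And>k. k \<in> {0..<int i} \<Longrightarrow> Dcoeff \<beta> \<alpha> (- int i) b k = 0"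
    using Dcoeff_local_solution[of i \<beta> \<alpha> "- int i"] by blast
  define s where "s = (\<Sum>k\<in>{0..int i}. w k * (cmod (b k))\<^sup>2)"
  obtain k0 where k0: "b k0 \<noteq> 0" using b(1) by blast
  have "0 < s" unfolding s_def
    by (rule sum_pos2[of _ k0]) (use k0 b(2)[of k0] w_pos w0 in auto)
  define a where "a = (\<lambda>k. of_real (1 / sqrt s) * b k)"
  have supp: "a k = 0" if "k \<notin> {0..int i}" for k using b(2)[OF that] by (simp add: a_def)
  have nsum: "(\<Sum>k\<in>{0..int i}. w k * (cmod (a k))\<^sup>2) = 1"
  proof -
    have "w k * (cmod (a k))\<^sup>2 = w k * (cmod (b k))\<^sup>2 / s" for k
      using \<open>0 < s\<close> by (simp add: a_def norm_mult norm_divide power_mult_distrib power_divide)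
    then show ?thesis using \<open>0 < s\<close> by (simp add: s_def flip: sum_divide_distrib)
  qed
  have aH: "homog (- int i) a \<in> Hspace w" "(Hnorm w (homog (- int i) a))\<^sup>2 = 1"
    using homog_finite_support[of w, OF w0, of "{0..int i}" a "- int i"] supp nsum by auto
  have n1: "Hnorm w (homog (- int i) a) = 1"
    using aH(2) Hnorm_nonneg[of w, OF w0, of "homog (- int i) a"] by (simp add: power2_eq_1_iff)
  let ?d = "Dcoeff \<beta> \<alpha> (- int i) a"
  \<comment> \<open>The value at \<open>k\<close> involves only \<open>a(k)\<close> and
    \<open>a(k + 1)\<close>: for \<open>k < -1\<close> or \<open>k > i\<close> both vanish, and for
    \<open>0 \<le> k < i\<close> the recurrence holds.\<close>
  have d0: "?d k = 0" if "k \<notin> {-1, int i}" for k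
  proof (cases "k \<in> {0..<int i}")
    case True
    have "?d k = of_real (1 / sqrt s) * Dcoeff \<beta> \<alpha> (- int i) b k"
      by (simp add: Dcoeff_def a_def algebra_simps)
    then show ?thesis using b(3)[OF True] by simp
  next
    case False
    then show ?thesis using that supp[of k] supp[of "k + 1"] by (auto simp: Dcoeff_def)
  qed
  have dH: "homog (1 - int i) ?d \<in> Hspace w"
    "(Hnorm w (homog (1 - int i) ?d))\<^sup>2 = (\<Sum>k\<in>{-1, int i}. w k * (cmod (?d k))\<^sup>2)"
    using homog_finite_support[of w, OF w0, of "{-1, int i}" ?d] d0 by auto
  have dl: "?d (-1) = - \<alpha> (-1) * a 0" and dr: "?d (int i) = \<beta> 0 * a (int i)"
    using supp[of "-1"] supp[of "int i + 1"] by (auto simp: Dcoeff_def)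
  \<comment> \<open>Each weighted point mass is at most the total mass 1; this is used at the end
    points 0 and \<open>i\<close>.\<close>
  have pt: "w k * (cmod (a k))\<^sup>2 \<le> 1" if "k \<in> {0..int i}" for k
    using member_le_sum[of k "{0..int i}" "\<lambda>k. w k * (cmod (a k))\<^sup>2"] that nsum w0 by auto
  have "(Hnorm w (homog (1 - int i) ?d))\<^sup>2
      = (cmod (\<alpha> (-1)))\<^sup>2 * w (-1) / w 0 * (w 0 * (cmod (a 0))\<^sup>2)
        + (cmod (\<beta> 0))\<^sup>2 * (w (int i) * (cmod (a (int i)))\<^sup>2)"
    using w_pos[of 0] by (simp add: dH(2) dl dr norm_mult power_mult_distrib)
  also have "\<dots> \<le> (cmod (\<alpha> (-1)))\<^sup>2 * w (-1) / w 0 * 1 + (cmod (\<beta> 0))\<^sup>2 * 1"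
    by (intro add_mono mult_left_mono pt) (auto simp: w0)
  finally have "Hnorm w (homog (1 - int i) ?d)
      \<le> sqrt ((cmod (\<beta> 0))\<^sup>2 + (cmod (\<alpha> (-1)))\<^sup>2 * w (-1) / w 0)"
    by (intro real_le_rsqrt) simp
  moreover have eq: "Dformal \<beta> \<alpha> (homog (- int i) a) = homog (1 - int i) ?d"
    by (simp add: Dformal_homog)
  moreover have "(homog (- int i) a, Dformal \<beta> \<alpha> (homog (- int i) a)) \<in> Dmin \<beta> \<alpha> w"
    unfolding Dmin_def
    using homog_in_alg_A0[of "{0..int i}" a "- int i"] supp aH(1) dH(1) eq
    by (intro op_closure_superset) auto
  ultimately show "\<exists>a. homog (- int i) a \<in> Hspace w \<and> Hnorm w (homog (- int i) a) = 1 \<and>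
    (homog (- int i) a, Dformal \<beta> \<alpha> (homog (- int i) a)) \<in> Dmin \<beta> \<alpha> w \<and>
    Hnorm w (Dformal \<beta> \<alpha> (homog (- int i) a))
      \<le> sqrt ((cmod (\<beta> 0))\<^sup>2 + (cmod (\<alpha> (-1)))\<^sup>2 * w (-1) / w 0)"
    using aH(1) n1 by (intro exI[of _ a] conjI) (simp_all only:)
qed

section \<open>Contradiction with compactness for extensions of the minimal operator\<close>

theorem theorem6p4:
  fixes w :: "int \<Rightarrow> real" and \<alpha> \<beta> :: "int \<Rightarrow> complex" and \<beta>_pinf \<beta>_minf :: complex
  assumes w_pos: "\<And>k. w k > 0"
    and w_sum: "(w has_sum 1) UNIV"
    and lim_pinf: "((\<lambda>k. \<beta> k - \<beta> (k - 1)) \<longlongrightarrow> \<beta>_pinf) at_top"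
    and lim_minf: "((\<lambda>k. \<beta> k - \<beta> (k - 1)) \<longlongrightarrow> \<beta>_minf) at_bot"
    and pinf_nz: "\<beta>_pinf \<noteq> 0"
    and minf_nz: "\<beta>_minf \<noteq> 0"
    and alpha: "(\<lambda>k. (cmod (\<beta> k - \<alpha> k))\<^sup>2 * w k) summable_on UNIV"
  shows "\<not> (\<exists>D. closed_operator w D \<and> Dmin \<beta> \<alpha> w \<subseteq> D \<and> D \<subseteq> Dmax \<beta> \<alpha> w \<and>
               compact_parametrices w D)"
proof
  assume "\<exists>D. closed_operator w D \<and> Dmin \<beta> \<alpha> w \<subseteq> D \<and> D \<subseteq> Dmax \<beta> \<alpha> w \<and>
               compact_parametrices w D"
  then obtain D S where D: "closed_operator w D" "Dmin \<beta> \<alpha> w \<subseteq> D"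
    and S: "is_inv_sqrt w (one_plus (D O adjoint_op w D)) S" "compact_operator w S"
    unfolding compact_parametrices_def by blast
  have w0: "\<And>k. 0 \<le> w k" using w_pos less_imp_le by blast
  have DH: "D \<subseteq> Hspace w \<times> Hspace w"
    using D(1) unfolding closed_operator_def linear_operator_def by blast
  obtain a where a: "\<And>i. homog (- int i) (a i) \<in> Hspace w"
    "\<And>i. Hnorm w (homog (- int i) (a i)) = 1"
    "\<And>i. (homog (- int i) (a i), Dformal \<beta> \<alpha> (homog (- int i) (a i))) \<in> Dmin \<beta> \<alpha> w"
    "\<And>i. Hnorm w (Dformal \<beta> \<alpha> (homog (- int i) (a i)))
      \<le> sqrt ((cmod (\<beta> 0))\<^sup>2 + (cmod (\<alpha> (-1)))\<^sup>2 * w (-1) / w 0)"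
    using approximate_null_vectors[of w \<beta> \<alpha>, OF w_pos] by blast
  \<comment> \<open>The test vectors have degrees \<open>-i\<close>, and their unit norm supplies
    the uniform bound 1.\<close>
  have weak: "(\<lambda>i. Hinner w f (homog (- int i) (a i))) \<longlonglongrightarrow> 0" if "f \<in> Hspace w" for f
    using Hinner_homog_tendsto_0[of w, OF w0 that a(1), of 1] a(2) by simp
  \<comment> \<open>The graph of \<open>Dmin\<close> lies in that of \<open>D\<close>, so the same
    vectors and images serve for every such extension \<open>D\<close>.\<close>
  show False
    by (rule not_compact_inv_sqrt[of w, OF w0 S DH _ a(2) a(4) weak]) (use a(3) D(2) in blast)+
qed

end
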